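(* Let $A\in\mathbb{R}^{m\times n}$ have full column rank, let $b\in\mathbb{R}^m$ be such that $Ax=b$ is consistent with solution $x^*$, let $G\in\mathbb{R}^{m\times m}$ be symmetric positive definite and $\widehat G:=A^TGA$, and let $1\le l\le n$. Let $\Omega_0,\Omega_1,\dots\in\mathbb{R}^{n\times l}$ be independent random matrices with i.i.d. $N(0,1)$ entries and $$T_j:=I_n-\Omega_j(\Omega_j^TA^TGA\Omega_j)^{-1}\Omega_j^TA^TGA,$$ the error propagation matrices of the iteration $x^{k+1}=x^k+\Omega_k(\Omega_k^TA^TGA\Omega_k)^{-1}\Omega_k^TA^TG(b-Ax^k)$, with $e^0=x^0-x^*$ deterministic. Let $\kappa$ be the (2-norm) condition number of $A^TGA$ and $\rho:=1-\frac{1}{n\kappa}$. Then $\rho<1$ and for every $k\ge0$ $$\mathbb{E}\big[\|T_k\cdots T_0e^0\|_{\widehat G}^2\big]\le\rho\,\mathbb{E}\big[\|T_{k-1}\cdots T_0e^0\|_{\widehat G}^2\big],\qquad \mathbb{E}\big[\|T_k\cdots T_0e^0\|_{\widehat G}^2\big]\le\rho^{k+1}\|e^0\|_{\widehat G}^2 .$$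
   Context: For symmetric positive definite $M$, $\|x\|_M:=\sqrt{x^TMx}$. The empty product of $T_j$'s is $I_n$. *)

theory Defs
  imports "HOL-Analysis.Analysis" "HOL-Probability.Probability"
begin

definition spd :: "real^'n^'n \<Rightarrow> bool" where
  "spd M \<longleftrightarrow> transpose M = M \<and> (\<forall>x. x \<noteq> 0 \<longrightarrow> x \<bullet> (M *v x) > 0)"

definition mnorm :: "real^'n^'n \<Rightarrow> real^'n \<Rightarrow> real" where
  "mnorm M x = sqrt (x \<bullet> (M *v x))"

definition cond2 :: "real^'n^'n \<Rightarrow> real" where
  "cond2 M = onorm (\<lambda>x. M *v x) * onorm (\<lambda>x. matrix_inv M *v x)"

definition Tmat :: "real^'n^'m \<Rightarrow> real^'m^'m \<Rightarrow> real^'l^'n \<Rightarrow> real^'n^'n" where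
  "Tmat A G W = mat 1 - W ** matrix_inv (transpose W ** (transpose A ** G ** A) ** W)
                 ** transpose W ** (transpose A ** G ** A)"

fun Tprod :: "real^'n^'m \<Rightarrow> real^'m^'m \<Rightarrow> (nat \<Rightarrow> real^'l^'n) \<Rightarrow> nat \<Rightarrow> real^'n^'n" where
  "Tprod A G W 0 = mat 1"
| "Tprod A G W (Suc k) = Tmat A G (W k) ** Tprod A G W k"

end

(*
With B = A^T G A, the matrix T_j maps e to its residual after B-orthogonal projection onto the range
of Omega_j, provided Omega_j is injective. Hence |T_j e|_B <= |e - t w|_B for every column w of Omega_j
and every t, and the best t gives |T_j e|_B^2 <= |e|_B^2 - (w . Be)^2 / (|B| |w|^2). Since w is
independent of the earlier error e, and E[w_i w_j / |w|^2] is 1/n for i = j and 0 otherwise (the law of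
w is invariant under sign changes and permutations of the coordinates), the expected decrease is at
least E|Be|^2 / (n |B|) >= E|e|_B^2 / (n kappa). A single column suffices, as the rate does not involve l.
Injectivity holds almost surely: the non-injective matrices lie in a smooth image of hyperplanes, so
they form a Lebesgue null set.
*)
theory Submission
  imports Defs
begin

section \<open>The sketched step\<close>

text \<open>The quadratic form of the product at \<open>x\<close> is that of \<open>G\<close> at
  \<open>A *v x\<close>, which is nonzero by injectivity. It is applied to the system matrix, and to
  a sketch \<open>W\<close> with \<open>B\<close> in the role of \<open>G\<close>.\<close>

lemma spd_gram:
  fixes A :: "real^'n^'m" and G :: "real^'m^'m"
  assumes "spd G" and "inj ((*v) A)"
  shows "spd (transpose A ** G ** A)"
proof -
  have "x \<bullet> ((transpose A ** G ** A) *v x) > 0" if "x \<noteq> 0" for x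
  proof -
    have "A *v x \<noteq> 0"
      using assms(2) that by (metis injD matrix_vector_mult_0_right)
    then show ?thesis
      using assms(1) unfolding spd_def
      by (metis dot_lmul_matrix matrix_vector_mul_assoc transpose_matrix_vector transpose_transpose)
  qed
  then show ?thesis
    using assms(1) by (simp add: spd_def matrix_transpose_mul transpose_transpose matrix_mul_assoc)
qed

lemma matrix_inv_cancel:
  fixes A :: "real^'n^'n"
  assumes "invertible A"
  shows "A *v (matrix_inv A *v x) = x" "matrix_inv A *v (A *v x) = x"
  using someI_ex[OF assms[unfolded invertible_def], folded matrix_inv_def]
  by (simp_all add: matrix_vector_mul_assoc)

lemma spd_invertible:
  assumes "spd B"
  shows "invertible B"
proof -
  have "\<forall>x. B *v x = 0 \<longrightarrow> x = 0"
    using assms unfolding spd_def by (metis inner_zero_right less_irrefl)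
  then show ?thesis
    by (simp add: invertible_left_inverse matrix_left_invertible_ker)
qed

lemma dot_matrix_transpose:
  fixes W :: "real^'l^'n"
  shows "x \<bullet> (W *v z) = (transpose W *v x) \<bullet> z"
  by (metis dot_lmul_matrix transpose_matrix_vector)

lemma spd_self_adjoint: "spd B \<Longrightarrow> x \<bullet> (B *v y) = (B *v x) \<bullet> y"
  by (metis dot_matrix_transpose spd_def)

lemma mnorm_sq: "spd B \<Longrightarrow> (mnorm B x)\<^sup>2 = x \<bullet> (B *v x)"
  unfolding mnorm_def spd_def
  by (metis inner_zero_left less_eq_real_def real_sqrt_pow2)

text \<open>Pythagoras in the \<open>B\<close> inner product: every competitor differs from the new
  error by an element of the range of \<open>W\<close>. The choice \<open>z = 0\<close> gives
  monotonicity, a multiple of an axis vector the quantitative decrease.\<close>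

lemma Tmat_best_approximation:
  fixes A :: "real^'n^'m" and G :: "real^'m^'m" and W :: "real^'l^'n"
  defines "B \<equiv> transpose A ** G ** A"
  assumes B: "spd B" and W: "inj ((*v) W)"
  shows "(mnorm B (Tmat A G W *v e))\<^sup>2 \<le> (mnorm B (e - W *v z))\<^sup>2"
proof -
  define S where "S = transpose W ** B ** W"
  define s where "s = matrix_inv S *v (transpose W *v (B *v e))"
  define u where "u = e - W *v s"
  have S: "spd S" unfolding S_def by (rule spd_gram[OF B W])
  have u: "Tmat A G W *v e = u"
    by (simp add: Tmat_def u_def s_def S_def B_def matrix_vector_mult_diff_rdistrib
        matrix_vector_mul_assoc matrix_mul_assoc)
  have "S *v s = transpose W *v (B *v e)"
    unfolding s_def by (rule matrix_inv_cancel[OF spd_invertible[OF S]])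
  \<comment> \<open>the new error is \<open>B\<close>-orthogonal to the range of \<open>W\<close>\<close>
  then have orth: "transpose W *v (B *v u) = 0"
    by (simp add: u_def S_def matrix_vector_mult_diff_distrib matrix_vector_mul_assoc matrix_mul_assoc)
  define d where "d = W *v (s - z)"
  have ez: "e - W *v z = u + d"
    by (simp add: u_def d_def matrix_vector_mult_diff_distrib)
  have 1: "(B *v u) \<bullet> d = 0"
    unfolding d_def dot_matrix_transpose orth by simp
  have 2: "u \<bullet> (B *v d) = 0"
    using 1 spd_self_adjoint[OF B] by simp
  have 3: "d \<bullet> (B *v d) \<ge> 0"
    using mnorm_sq[OF B, of d] by (metis zero_le_power2)
  show ?thesis
    unfolding u ez mnorm_sq[OF B] using 1 2 3
    by (simp add: matrix_vector_right_distrib inner_add_left inner_add_right inner_commute)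
qed

text \<open>Exact line search along column \<open>c\<close> is one of the competitors. Bounding
  \<open>w \<bullet> (B *v w)\<close> by the operator norm leaves a decrease that depends only on
  the direction of \<open>w\<close>.\<close>

lemma Tmat_step_bound:
  fixes A :: "real^'n^'m" and G :: "real^'m^'m" and W :: "real^'l^'n"
  defines "B \<equiv> transpose A ** G ** A"
  assumes B: "spd B" and W: "inj ((*v) W)"
  shows "(mnorm B (Tmat A G W *v e))\<^sup>2
     \<le> (mnorm B e)\<^sup>2 - (column c W \<bullet> (B *v e))\<^sup>2 / (onorm ((*v) B) * (column c W \<bullet> column c W))"
proof -
  define w where "w = column c W"
  define b where "b = w \<bullet> (B *v e)"
  define q where "q = w \<bullet> (B *v w)"
  have w: "W *v axis c t = t *\<^sub>R w" for t
    by (simp add: w_def matrix_vector_mult_basis matrix_vector_mul_component vec_eq_iff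
        matrix_vector_mult_def axis_def column_def if_distrib cong: if_cong)
  have "w = W *v axis c 1" using w[of 1] by simp
  moreover have "axis c (1::real) \<noteq> (0::real^'l)" by simp
  ultimately have "w \<noteq> 0"
    using W by (metis injD matrix_vector_mult_0_right)
  then have q: "q > 0" using B by (simp add: q_def spd_def)
  have bl: "bounded_linear ((*v) B)" by (rule matrix_vector_mul_bounded_linear)
  have "q \<le> norm w * norm (B *v w)" unfolding q_def by (rule norm_cauchy_schwarz)
  also have "\<dots> \<le> norm w * (onorm ((*v) B) * norm w)"
    by (intro mult_left_mono onorm[OF bl]) auto
  finally have qle: "q \<le> onorm ((*v) B) * (w \<bullet> w)"
    by (simp add: dot_square_norm power2_eq_square mult_ac)
  \<comment> \<open>\<open>b / q\<close> minimises the energy of \<open>e - t w\<close> over real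
    \<open>t\<close>; \<open>axis c (b/q)\<close> selects this multiple of the column.\<close>
  have "(mnorm B (Tmat A G W *v e))\<^sup>2 \<le> (mnorm B (e - (b / q) *\<^sub>R w))\<^sup>2"
    using Tmat_best_approximation[OF B[unfolded B_def] W, of e "axis c (b/q)"] w by (simp add: B_def)
  also have "\<dots> = (mnorm B e)\<^sup>2 - 2 * (b/q) * b + (b/q)^2 * q"
    unfolding mnorm_sq[OF B]
    using spd_self_adjoint[OF B, of e w]
    by (simp add: matrix_vector_mult_diff_distrib matrix_vector_mult_scaleR inner_diff_left inner_diff_right
        b_def q_def inner_commute power2_eq_square algebra_simps)
  also have "\<dots> = (mnorm B e)\<^sup>2 - b\<^sup>2 / q"
    using q by (simp add: power2_eq_square field_simps)
  also have "\<dots> \<le> (mnorm B e)\<^sup>2 - b\<^sup>2 / (onorm ((*v) B) * (w \<bullet> w))"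
    using q qle by (intro diff_left_mono divide_left_mono) auto
  finally show ?thesis by (simp add: b_def w_def)
qed

section \<open>Operator norm bounds and the condition number\<close>

lemma spd_onorm_pos:
  fixes B :: "real^'n^'n"
  assumes "spd B"
  shows "0 < onorm ((*v) B)" "0 < onorm ((*v) (matrix_inv B))"
proof -
  have ax: "axis k (1::real) \<noteq> (0::real^'n)" for k by simp
  have "B *v x \<noteq> 0" "matrix_inv B *v x \<noteq> 0" if "x \<noteq> 0" for x
    using matrix_inv_cancel[OF spd_invertible[OF assms], of x] that
    by (metis matrix_vector_mult_0_right)+
  then show "0 < onorm ((*v) B)" "0 < onorm ((*v) (matrix_inv B))"
    unfolding onorm_pos_lt[OF matrix_vector_mul_bounded_linear] using ax by blast+
qed

text \<open>Cauchy-Schwarz, after writing \<open>e\<close> as the inverse applied to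
  \<open>B *v e\<close>. This supplies the second factor of \<open>cond2\<close>; the first comes
  from the step bound.\<close>

lemma spd_quadratic_le_onorm_inv:
  fixes B :: "real^'n^'n"
  assumes "spd B"
  shows "e \<bullet> (B *v e) \<le> onorm ((*v) (matrix_inv B)) * ((B *v e) \<bullet> (B *v e))"
proof -
  let ?y = "B *v e"
  have "e \<bullet> ?y = (matrix_inv B *v ?y) \<bullet> ?y"
    by (simp add: matrix_inv_cancel[OF spd_invertible[OF assms]])
  also have "\<dots> \<le> norm (matrix_inv B *v ?y) * norm ?y" by (rule norm_cauchy_schwarz)
  also have "\<dots> \<le> (onorm ((*v) (matrix_inv B)) * norm ?y) * norm ?y"
    by (intro mult_right_mono onorm matrix_vector_mul_bounded_linear) auto
  finally show ?thesis by (simp add: dot_square_norm power2_eq_square mult_ac)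
qed

text \<open>Pushing an axis vector through the inverse and then through \<open>B\<close> returns it,
  so the two operator norms cannot multiply to less than 1. This puts the rate into [0, 1).\<close>

lemma cond2_ge_1:
  fixes B :: "real^'n^'n"
  assumes "spd B"
  shows "1 \<le> cond2 B"
proof -
  note c = matrix_inv_cancel[OF spd_invertible[OF assms]]
  have bl: "bounded_linear ((*v) M)" for M :: "real^'n^'n"
    by (rule matrix_vector_mul_bounded_linear)
  have "norm (axis k 1 :: real^'n) \<le> onorm ((*v) B) * onorm ((*v) (matrix_inv B)) * norm (axis k 1 :: real^'n)" for k
  proof -
    have "norm (axis k 1 :: real^'n) = norm (B *v (matrix_inv B *v axis k 1))" by (simp only: c)
    also have "\<dots> \<le> onorm ((*v) B) * (onorm ((*v) (matrix_inv B)) * norm (axis k 1 :: real^'n))"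
      by (intro order_trans[OF onorm[OF bl]] mult_left_mono onorm bl onorm_pos_le)
    finally show ?thesis by (simp add: mult_ac)
  qed
  then show ?thesis by (simp add: cond2_def)
qed

text \<open>With \<open>y = B *v e\<close>, the energy of \<open>K *\<^sub>R e - y\<close> is
  nonnegative and at most \<open>K\<close> times the right side minus the left side. The bound
  serves to dominate the coordinates of \<open>B *v err k w\<close>.\<close>

lemma spd_norm_sq_le:
  fixes B :: "real^'n^'n"
  assumes "spd B"
  shows "(B *v e) \<bullet> (B *v e) \<le> onorm ((*v) B) * (e \<bullet> (B *v e))"
proof -
  define K y where "K = onorm ((*v) B)" and "y = B *v e"
  have K: "K > 0" unfolding K_def by (rule spd_onorm_pos[OF assms])
  have "y \<bullet> (B *v y) \<le> norm y * norm (B *v y)" by (rule norm_cauchy_schwarz)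
  also have "\<dots> \<le> norm y * (K * norm y)"
    unfolding K_def by (intro mult_left_mono onorm matrix_vector_mul_bounded_linear) auto
  finally have yy: "y \<bullet> (B *v y) \<le> K * (y \<bullet> y)"
    by (simp add: dot_square_norm power2_eq_square mult_ac)
  have "0 \<le> (mnorm B (K *\<^sub>R e - y))\<^sup>2" by simp
  also have "\<dots> = K\<^sup>2 * (e \<bullet> y) - 2 * K * (y \<bullet> y) + y \<bullet> (B *v y)"
    unfolding mnorm_sq[OF assms] using spd_self_adjoint[OF assms, of e y]
    by (simp add: matrix_vector_mult_diff_distrib matrix_vector_mult_scaleR inner_diff_left inner_diff_right
        y_def inner_commute power2_eq_square algebra_simps)
  also have "\<dots> \<le> K * (K * (e \<bullet> y) - y \<bullet> y)"
    using yy by (simp add: power2_eq_square algebra_simps)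
  finally have "y \<bullet> y \<le> K * (e \<bullet> y)"
    using K by (simp add: zero_le_mult_iff)
  then show ?thesis by (simp add: K_def y_def)
qed

section \<open>Gaussian vectors and matrices\<close>

lemma negligible_not_inj:
  assumes "CARD('l) \<le> CARD('n)"
  shows "negligible {W :: real^'l^'n. \<not> inj ((*v) W)}"
proof -
  \<comment> \<open>The dimension bound gives each column index its own row, so that one column can
    store a coefficient for every other column.\<close>
  obtain g :: "'l \<Rightarrow> 'n" where g: "inj g"
    using assms card_le_inj[of "UNIV::'l set" "UNIV::'n set"] by auto
  \<comment> \<open>\<open>f c\<close> overwrites column \<open>c\<close> by a combination of the
    others, with coefficients read from column \<open>c\<close>. Row \<open>g c\<close> stores none,
    so it can be set to 0, making the domain a hyperplane; \<open>f c\<close> is polynomial and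
    keeps it null.\<close>
  define S where "S c = {V :: real^'l^'n. V $ g c $ c = 0}" for c
  define f where "f c V = (\<chi> i d. if d = c then \<Sum>d'\<in>-{c}. V $ g d' $ c * V $ i $ d' else V $ i $ d)"
    for c and V :: "real^'l^'n"
  have "negligible (f c ` S c)" for c
  proof (rule negligible_differentiable_image_negligible)
    have "S c = {V. axis (g c) (axis c 1) \<bullet> V = 0}"
      by (simp add: S_def inner_axis')
    then show "negligible (S c)"
      using negligible_hyperplane[of "axis (g c) (axis c 1) :: real^'l^'n" 0]
      by simp
    have lin: "(\<lambda>V :: real^'l^'n. V $ i $ d) differentiable (at V within S c)" for i d V
      by (intro bounded_linear_imp_differentiable bounded_linear_compose[OF bounded_linear_vec_nth]
          bounded_linear_vec_nth)
    show "f c differentiable_on S c"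
      unfolding differentiable_on_def
    proof safe
      fix V
      show "f c differentiable (at V within S c)"
      proof (subst differentiable_componentwise_within, rule ballI)
        fix b :: "real^'l^'n" assume "b \<in> Basis"
        then obtain i d where b: "b = axis i (axis d 1)"
          by (auto simp: Basis_vec_def)
        show "(\<lambda>V. f c V \<bullet> b) differentiable (at V within S c)"
          by (cases "d = c") (auto simp: b f_def inner_axis intro!: differentiable_sum differentiable_mult lin)
      qed
    qed
  qed simp
  then have "negligible (\<Union>c. f c ` S c)" by (intro negligible_Union) auto
  \<comment> \<open>In a non-injective \<open>W\<close> some column \<open>c\<close> is a combination of the others; the unused column \<open>c\<close>
      of \<open>V \<in> S c\<close> stores the coefficients, with a slot \<open>g c\<close> to spare.\<close>
  moreover have "{W :: real^'l^'n. \<not> inj ((*v) W)} \<subseteq> (\<Union>c. f c ` S c)"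
  proof safe
    fix W :: "real^'l^'n"
    assume "\<not> inj ((*v) W)"
    then obtain z where z: "W *v z = 0" "z \<noteq> 0"
      unfolding matrix_left_invertible_injective[symmetric] matrix_left_invertible_ker by blast
    then obtain c where c: "z $ c \<noteq> 0" by (auto simp: vec_eq_iff)
    \<comment> \<open>In rows outside the range of \<open>g\<close>, \<open>inv g\<close> yields
      arbitrary entries of column \<open>c\<close>; \<open>f c\<close> never reads them.\<close>
    define V where "V = (\<chi> i d. if d = c then (if i = g c then 0 else - z $ (inv g i) / z $ c) else W $ i $ d)"
    have col: "W $ i $ c = (\<Sum>d\<in>-{c}. (- z $ d / z $ c) * W $ i $ d)" for i
    proof -
      have "0 = (\<Sum>d\<in>UNIV. W $ i $ d * z $ d)"
        using z(1) by (simp add: vec_eq_iff matrix_vector_mult_def)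
      also have "\<dots> = W $ i $ c * z $ c + (\<Sum>d\<in>-{c}. W $ i $ d * z $ d)"
        by (subst sum.remove[of _ c]) (auto simp: Compl_eq_Diff_UNIV)
      finally have "W $ i $ c = - (\<Sum>d\<in>-{c}. W $ i $ d * z $ d) / z $ c"
        using c by (simp add: field_simps)
      then show ?thesis
        by (simp add: sum_negf sum_divide_distrib mult_ac)
    qed
    have "V \<in> S c" by (simp add: V_def S_def)
    moreover have "f c V = W"
      using g col
      by (auto simp: f_def V_def vec_eq_iff inj_eq intro!: sum.cong)
    ultimately show "W \<in> (\<Union>c. f c ` S c)" by auto
  qed
  ultimately show ?thesis by (rule negligible_subset)
qed

text \<open>Injectivity makes the singletons \<open>{h j}\<close> disjoint blocks of an independent
  family; each block is then read at its only coordinate.\<close>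

lemma (in prob_space) indep_vars_reindex_inj:
  assumes "indep_vars M' X I" "inj_on h J" "h ` J \<subseteq> I"
  shows "indep_vars (\<lambda>j. M' (h j)) (\<lambda>j. X (h j)) J"
proof -
  have "indep_vars (\<lambda>j. PiM {h j} M') (\<lambda>j \<omega>. restrict (\<lambda>i. X i \<omega>) {h j}) J"
    using assms by (intro indep_vars_restrict) (auto simp: disjoint_family_on_def inj_on_def)
  then have "indep_vars (\<lambda>j. M' (h j)) (\<lambda>j \<omega>. (restrict (\<lambda>i. X i \<omega>) {h j}) (h j)) J"
    by (rule indep_vars_compose2) simp
  then show ?thesis by simp
qed

text \<open>Both measures are compared on boxes, where density and indicator factor over the
  coordinates and the integral splits.\<close>

lemma PiM_density:
  fixes I :: "'i set" and f :: "real \<Rightarrow> ennreal"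
  assumes "finite I" and f[measurable]: "f \<in> borel_measurable borel"
    and sf: "sigma_finite_measure (density lborel f)"
  shows "(\<Pi>\<^sub>M i\<in>I. density lborel f) = density (\<Pi>\<^sub>M i\<in>I. lborel) (\<lambda>x. \<Prod>i\<in>I. f (x i))"
proof -
  interpret D: product_sigma_finite "\<lambda>_::'i. density lborel f"
    by (rule product_sigma_finite.intro) (rule sf)
  interpret L: product_sigma_finite "\<lambda>_::'i. lborel :: real measure"
    by standard
  note [simp] = \<open>finite I\<close>
  show ?thesis
  proof (rule D.PiM_eqI[symmetric])
    show "sets (density (\<Pi>\<^sub>M i\<in>I. lborel) (\<lambda>x. \<Prod>i\<in>I. f (x i))) = sets (\<Pi>\<^sub>M i\<in>I. density lborel f)"
      by (simp cong: sets_PiM_cong)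
    fix E :: "'i \<Rightarrow> real set"
    assume "\<And>i. i \<in> I \<Longrightarrow> E i \<in> sets (density lborel f)"
    then have E[measurable]: "\<And>i. i \<in> I \<Longrightarrow> E i \<in> sets borel" by simp
    have PE: "Pi\<^sub>E I E \<in> sets (\<Pi>\<^sub>M i\<in>I. lborel)"
      by (intro sets_PiM_I_finite) (auto simp: E)
    have "emeasure (density (\<Pi>\<^sub>M i\<in>I. lborel) (\<lambda>x. \<Prod>i\<in>I. f (x i))) (Pi\<^sub>E I E)
        = (\<integral>\<^sup>+x. (\<Prod>i\<in>I. f (x i)) * indicator (Pi\<^sub>E I E) x \<partial>(\<Pi>\<^sub>M i\<in>I. lborel))"
      using PE by (intro emeasure_density) measurable
    also have "\<dots> = (\<integral>\<^sup>+x. (\<Prod>i\<in>I. f (x i) * indicator (E i) (x i)) \<partial>(\<Pi>\<^sub>M i\<in>I. lborel))"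
    proof (rule nn_integral_cong)
      fix x :: "'i \<Rightarrow> real" assume "x \<in> space (\<Pi>\<^sub>M i\<in>I. lborel)"
      then have "indicator (Pi\<^sub>E I E) x = (\<Prod>i\<in>I. indicator (E i) (x i) :: ennreal)"
        by (auto simp: space_PiM PiE_iff indicator_def prod_zero_iff)
      then show "(\<Prod>i\<in>I. f (x i)) * indicator (Pi\<^sub>E I E) x = (\<Prod>i\<in>I. f (x i) * indicator (E i) (x i))"
        by (simp add: prod.distrib)
    qed
    also have "\<dots> = (\<Prod>i\<in>I. \<integral>\<^sup>+x. f x * indicator (E i) x \<partial>lborel)"
      by (rule L.product_nn_integral_prod) auto
    also have "\<dots> = (\<Prod>i\<in>I. emeasure (density lborel f) (E i))"
      by (intro prod.cong refl emeasure_density[symmetric]) auto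
    finally show "emeasure (density (\<Pi>\<^sub>M i\<in>I. lborel) (\<lambda>x. \<Prod>i\<in>I. f (x i))) (Pi\<^sub>E I E)
        = (\<Prod>i\<in>I. emeasure (density lborel f) (E i))" .
  qed simp
qed

text \<open>The joint law of the coordinates has a density with respect to product Lebesgue measure,
  so Lebesgue null sets are almost surely avoided.\<close>

lemma (in prob_space) AE_not_in_negligible:
  fixes X :: "'a \<Rightarrow> 'b::euclidean_space" and f :: "real \<Rightarrow> ennreal"
  assumes ind: "indep_vars (\<lambda>_. borel) (\<lambda>b w. X w \<bullet> b) Basis"
    and dist: "\<And>b. b \<in> Basis \<Longrightarrow> distributed M lborel (\<lambda>w. X w \<bullet> b) f"
    and S: "negligible S"
  shows "AE w in M. X w \<notin> S"
proof -
  obtain b0 :: 'b where b0: "b0 \<in> Basis" using nonempty_Basis by blast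
  have f[measurable]: "f \<in> borel_measurable borel"
    using distributed_borel_measurable[OF dist[OF b0]] by simp
  have rv[measurable]: "\<And>b. b \<in> Basis \<Longrightarrow> (\<lambda>w. X w \<bullet> b) \<in> borel_measurable M"
    using ind by (auto simp: indep_vars_def)
  have d: "distr M borel (\<lambda>w. X w \<bullet> b) = density lborel f" if "b \<in> Basis" for b
    using distributed_distr_eq_density[OF dist[OF that]] by (simp cong: distr_cong)
  have sf: "sigma_finite_measure (density lborel f)"
    using prob_space_distr[OF rv[OF b0]] unfolding d[OF b0]
    by (simp add: prob_space_imp_sigma_finite)
  have "distr M (\<Pi>\<^sub>M b\<in>Basis. borel) (\<lambda>w. \<lambda>b\<in>Basis. X w \<bullet> b) = (\<Pi>\<^sub>M b\<in>Basis. distr M borel (\<lambda>w. X w \<bullet> b))"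
    using indep_vars_iff_distr_eq_PiM'[where I = "Basis :: 'b set" and M' = "\<lambda>_. borel" and X = "\<lambda>b w. X w \<bullet> b"] ind rv
    by auto
  also have "\<dots> = (\<Pi>\<^sub>M b\<in>(Basis::'b set). density lborel f)"
    by (intro PiM_cong refl d)
  also have "\<dots> = density (\<Pi>\<^sub>M b\<in>Basis. lborel) (\<lambda>x. \<Prod>b\<in>Basis. f (x b))"
    by (rule PiM_density[OF _ f sf]) simp
  finally have law: "distr M (\<Pi>\<^sub>M b\<in>Basis. borel) (\<lambda>w. \<lambda>b\<in>Basis. X w \<bullet> b)
      = density (\<Pi>\<^sub>M b\<in>(Basis::'b set). lborel) (\<lambda>x. \<Prod>b\<in>Basis. f (x b))" .
  \<comment> \<open>\<open>S\<close> may fail to be Borel, so nullity is first stated for the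
    completion and then passed to \<open>lborel\<close>.\<close>
  have "AE y in lebesgue. y \<notin> S"
    using S by (simp add: negligible_iff_null_sets AE_not_in)
  then have "AE y in lborel. y \<notin> S" by (simp add: AE_completion_iff)
  then have "AE x in (\<Pi>\<^sub>M b\<in>(Basis::'b set). lborel). (\<Sum>b\<in>Basis. x b *\<^sub>R b) \<notin> S"
    by (subst (asm) lborel_eq) (rule AE_distrD, measurable)
  then have "AE x in density (\<Pi>\<^sub>M b\<in>(Basis::'b set). lborel) (\<lambda>x. \<Prod>b\<in>Basis. f (x b)).
      (\<Sum>b\<in>Basis. x b *\<^sub>R b) \<notin> S"
    by (subst AE_density) auto
  then have "AE w in M. (\<Sum>b\<in>Basis. (\<lambda>b\<in>Basis. X w \<bullet> b) b *\<^sub>R b) \<notin> S"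
    unfolding law[symmetric] by (rule AE_distrD[rotated]) measurable
  then show ?thesis by (simp add: euclidean_representation)
qed

section \<open>Symmetry and the moments of a Gaussian direction\<close>

lemma (in prob_space) indep_vars_integral_eq:
  fixes F :: "('i \<Rightarrow> 'b) \<Rightarrow> real"
  assumes X: "indep_vars N X UNIV" and Y: "indep_vars N Y UNIV"
    and eq: "\<And>i. distr M (N i) (X i) = distr M (N i) (Y i)"
    and F: "F \<in> borel_measurable (PiM UNIV N)"
  shows "(\<integral>w. F (\<lambda>i. X i w) \<partial>M) = (\<integral>w. F (\<lambda>i. Y i w) \<partial>M)"
proof -
  have rX: "X i \<in> measurable M (N i)" and rY: "Y i \<in> measurable M (N i)" for i
    using X Y by (auto simp: indep_vars_def)
  have "distr M (PiM UNIV N) (\<lambda>w. \<lambda>i\<in>UNIV. X i w) = distr M (PiM UNIV N) (\<lambda>w. \<lambda>i\<in>UNIV. Y i w)"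
    using indep_vars_iff_distr_eq_PiM[where I = UNIV and M' = N and X = X]
      indep_vars_iff_distr_eq_PiM[where I = UNIV and M' = N and X = Y] X Y rX rY eq
    by simp
  then have "integral\<^sup>L (distr M (PiM UNIV N) (\<lambda>w i. X i w)) F = integral\<^sup>L (distr M (PiM UNIV N) (\<lambda>w i. Y i w)) F"
    by (simp only: restrict_UNIV)
  moreover have "(\<lambda>w i. X i w) \<in> measurable M (PiM UNIV N)" "(\<lambda>w i. Y i w) \<in> measurable M (PiM UNIV N)"
    by (simp_all only: measurable_restrict[where I = UNIV, unfolded restrict_UNIV] rX rY)
  ultimately show ?thesis using F by (simp add: integral_distr)
qed

text \<open>The matrix w w^T / |w|^2 has trace 1 almost surely. Sign flips kill the off-diagonal
  means and exchanges equate the diagonal ones, so the mean is the identity divided by n.\<close>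

lemma (in prob_space) gaussian_direction_moments:
  fixes X :: "'n::finite \<Rightarrow> 'a \<Rightarrow> real"
  assumes ind: "indep_vars (\<lambda>_. borel) X UNIV"
    and dist: "\<And>i. distributed M lborel (X i) std_normal_density"
  shows "(\<integral>w. X i w * X j w / (\<Sum>k\<in>UNIV. (X k w)\<^sup>2) \<partial>M) = (if i = j then 1 / CARD('n) else 0)"
    and "integrable M (\<lambda>w. X i w * X j w / (\<Sum>k\<in>UNIV. (X k w)\<^sup>2))"
proof -
  define F where "F i j x = x i * x j / (\<Sum>k\<in>UNIV. (x k)\<^sup>2)" for i j :: 'n and x :: "'n \<Rightarrow> real"
  have [measurable]: "X k \<in> borel_measurable M" for k
    using ind by (auto simp: indep_vars_def)
  have Fm: "F i j \<in> borel_measurable (PiM UNIV (\<lambda>_. borel))" for i j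
    unfolding F_def by measurable
  have FmM[measurable]: "(\<lambda>w. F i j (\<lambda>k. X k w)) \<in> borel_measurable M" for i j
    unfolding F_def by measurable
  \<comment> \<open>This gives integrability. At \<open>x = 0\<close> the quotient is 0 by
    convention, so the bound holds there too.\<close>
  have bound: "\<bar>F i j x\<bar> \<le> 1" for i j x
  proof -
    let ?s = "\<Sum>k\<in>UNIV. (x k)\<^sup>2"
    have le: "(x k)\<^sup>2 \<le> ?s" for k by (intro member_le_sum) auto
    have "\<bar>x i * x j\<bar> \<le> ?s"
    proof (cases "\<bar>x i\<bar> \<le> \<bar>x j\<bar>")
      case True
      then have "\<bar>x i * x j\<bar> \<le> (x j)\<^sup>2"
        using mult_right_mono[OF True abs_ge_zero[of "x j"]] by (simp add: abs_mult power2_eq_square)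
      then show ?thesis using le[of j] by linarith
    next
      case False
      then have "\<bar>x i * x j\<bar> \<le> (x i)\<^sup>2"
        using mult_left_mono[OF _ abs_ge_zero[of "x i"], of "\<bar>x j\<bar>" "\<bar>x i\<bar>"]
        by (simp add: abs_mult power2_eq_square)
      then show ?thesis using le[of i] by linarith
    qed
    moreover have "?s \<ge> 0" by (intro sum_nonneg) auto
    ultimately show ?thesis by (auto simp add: F_def abs_divide divide_le_eq_1 less_eq_real_def)
  qed
  have int: "integrable M (\<lambda>w. F i j (\<lambda>k. X k w))" for i j
    by (rule integrable_const_bound[where B = 1]) (auto simp: bound)
  then show "integrable M (\<lambda>w. X i w * X j w / (\<Sum>k\<in>UNIV. (X k w)\<^sup>2))"
    unfolding F_def .
  have dXY: "distr M borel (X k) = distr M borel Y" if "distributed M lborel Y std_normal_density" for k Y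
    using distributed_distr_eq_density[OF dist[of k]] distributed_distr_eq_density[OF that]
    by (simp cong: distr_cong)
  have off: "(\<integral>w. F i j (\<lambda>k. X k w) \<partial>M) = 0" if "i \<noteq> j" for i j
  proof -
    \<comment> \<open>flipping the sign of \<open>X i\<close> preserves the joint law\<close>
    define Y where "Y k w = (if k = i then -1 else 1) * X k w" for k w
    have "indep_vars (\<lambda>_. borel) Y UNIV"
      unfolding Y_def by (rule indep_vars_compose2[OF ind]) measurable
    moreover have "distributed M lborel (Y k) std_normal_density" for k
      using normal_density_affine[OF dist[of k], where \<alpha> = "-1" and \<beta> = 0] dist[of k]
      by (cases "k = i") (simp_all add: Y_def[abs_def])
    ultimately have "(\<integral>w. F i j (\<lambda>k. X k w) \<partial>M) = (\<integral>w. F i j (\<lambda>k. Y k w) \<partial>M)"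
      by (intro indep_vars_integral_eq[OF ind _ _ Fm] dXY)
    also have "(\<lambda>w. F i j (\<lambda>k. Y k w)) = (\<lambda>w. - F i j (\<lambda>k. X k w))"
      using that by (auto simp: F_def Y_def power_mult_distrib fun_eq_iff if_distrib intro!: sum.cong)
    finally show ?thesis by simp
  qed
  have diag: "(\<integral>w. F i i (\<lambda>k. X k w) \<partial>M) = (\<integral>w. F j j (\<lambda>k. X k w) \<partial>M)" for i j
  proof -
    \<comment> \<open>exchanging \<open>X i\<close> and \<open>X j\<close> preserves the joint law\<close>
    define p where "p = Transposition.transpose i j"
    have p: "bij p" by (simp add: p_def)
    have "indep_vars (\<lambda>_. borel) (\<lambda>k. X (p k)) UNIV"
      using indep_vars_reindex_inj[OF ind, of p UNIV] p by (simp add: bij_is_inj)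
    then have "(\<integral>w. F i i (\<lambda>k. X k w) \<partial>M) = (\<integral>w. F i i (\<lambda>k. X (p k) w) \<partial>M)"
      by (intro indep_vars_integral_eq[OF ind _ _ Fm] dXY dist)
    also have "(\<lambda>w. F i i (\<lambda>k. X (p k) w)) = (\<lambda>w. F j j (\<lambda>k. X k w))"
    proof
      fix w
      show "F i i (\<lambda>k. X (p k) w) = F j j (\<lambda>k. X k w)"
        using sum.reindex_bij_betw[OF p, of "\<lambda>k. (X k w)\<^sup>2"] by (simp add: F_def p_def)
    qed
    finally show ?thesis .
  qed
  \<comment> \<open>At the zero vector the diagonal terms would sum to 0 instead of 1; one nonzero
    coordinate rules this out.\<close>
  have nz: "AE w in M. X i w \<noteq> 0" for i
  proof -
    have "AE x in lborel. x \<noteq> (0::real)"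
      by (rule AE_lborel_singleton)
    then have "AE x in density lborel (\<lambda>x. ennreal (std_normal_density x)). x \<noteq> 0"
      by (subst AE_density) auto
    then have "AE x in distr M lborel (X i). x \<noteq> 0"
      unfolding distributed_distr_eq_density[OF dist[of i]] .
    then show ?thesis by (rule AE_distrD[rotated]) simp
  qed
  have "(\<Sum>j\<in>UNIV. \<integral>w. F j j (\<lambda>k. X k w) \<partial>M) = (\<integral>w. (\<Sum>j\<in>UNIV. F j j (\<lambda>k. X k w)) \<partial>M)"
    by (rule Bochner_Integration.integral_sum[symmetric]) (rule int)
  also have "\<dots> = (\<integral>w. 1 \<partial>M)"
  proof (rule integral_cong_AE)
    show "AE w in M. (\<Sum>j\<in>UNIV. F j j (\<lambda>k. X k w)) = 1"
      using nz[of i]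
    proof eventually_elim
      case (elim w)
      have "(\<Sum>k\<in>UNIV. (X k w)\<^sup>2) > 0"
        using elim by (intro sum_pos2[of _ i]) auto
      then show ?case
        by (simp add: F_def power2_eq_square flip: sum_divide_distrib)
    qed
  qed auto
  finally have "(\<Sum>j\<in>UNIV. \<integral>w. F j j (\<lambda>k. X k w) \<partial>M) = 1" by (simp add: prob_space)
  moreover have "(\<Sum>j\<in>UNIV. \<integral>w. F j j (\<lambda>k. X k w) \<partial>M) = (\<Sum>j\<in>(UNIV::'n set). \<integral>w. F i i (\<lambda>k. X k w) \<partial>M)"
    by (intro sum.cong refl diag)
  ultimately have "(\<integral>w. F i i (\<lambda>k. X k w) \<partial>M) = 1 / CARD('n)"
    by (simp add: field_simps)
  then show "(\<integral>w. X i w * X j w / (\<Sum>k\<in>UNIV. (X k w)\<^sup>2) \<partial>M) = (if i = j then 1 / CARD('n) else 0)"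
    using off[of i j] unfolding F_def by auto
qed

section \<open>Measurability\<close>

lemma borel_measurable_det:
  fixes F :: "'a \<Rightarrow> real^'n^'n"
  assumes [measurable]: "\<And>i j. (\<lambda>x. F x $ i $ j) \<in> borel_measurable N"
  shows "(\<lambda>x. det (F x)) \<in> borel_measurable N"
  unfolding det_def by measurable

text \<open>On singular matrices \<open>matrix_inv\<close> is a junk value; that this value is the same for all of them
  makes \<open>matrix_inv\<close> Borel measurable.\<close>

lemma matrix_inv_entry:
  fixes A :: "real^'n^'n"
  shows "matrix_inv A $ i $ j =
    (if det A = 0 then (SOME A' :: real^'n^'n. False) $ i $ j
     else det (\<chi> i' j'. if j' = i then axis j 1 $ i' else A $ i' $ j') / det A)"
proof (cases "det A = 0")
  case True
  then have "(\<lambda>A'. A ** A' = mat 1 \<and> A' ** A = mat 1) = (\<lambda>_. False)"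
    using invertible_det_nz[of A] unfolding invertible_def by blast
  then show ?thesis using True by (simp only: matrix_inv_def if_True simp_thms)
next
  case False
  then have "invertible A" by (simp add: invertible_det_nz)
  \<comment> \<open>Column \<open>j\<close> of the inverse solves this linear system, so Cramer's
    rule gives its entries as quotients of determinants.\<close>
  then have "A *v (matrix_inv A *v axis j 1) = axis j 1" by (rule matrix_inv_cancel)
  then have "matrix_inv A *v axis j 1
      = (\<chi> k. det (\<chi> i' j'. if j' = k then axis j 1 $ i' else A $ i' $ j') / det A)"
    unfolding cramer[OF False] .
  moreover have "(matrix_inv A *v axis j 1) $ i = matrix_inv A $ i $ j"
    by (simp add: matrix_vector_mult_basis column_def)
  ultimately show ?thesis using False by simp
qed

lemma borel_measurable_matrix_inv:
  fixes F :: "'a \<Rightarrow> real^'n^'n"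
  assumes [measurable]: "\<And>i j. (\<lambda>x. F x $ i $ j) \<in> borel_measurable N"
  shows "(\<lambda>x. matrix_inv (F x) $ i $ j) \<in> borel_measurable N"
proof -
  have [measurable]: "(\<lambda>x. det (F x)) \<in> borel_measurable N"
    by (rule borel_measurable_det) measurable
  have [measurable]: "(\<lambda>x. det (\<chi> i' j'. if j' = i then axis j 1 $ i' else F x $ i' $ j')) \<in> borel_measurable N"
    by (rule borel_measurable_det) simp
  show ?thesis unfolding matrix_inv_entry by measurable
qed

lemma borel_measurable_matrix_mult:
  fixes F :: "'a \<Rightarrow> real^'n^'m" and H :: "'a \<Rightarrow> real^'p^'n"
  assumes [measurable]: "\<And>i j. (\<lambda>x. F x $ i $ j) \<in> borel_measurable N"
    "\<And>i j. (\<lambda>x. H x $ i $ j) \<in> borel_measurable N"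
  shows "(\<lambda>x. (F x ** H x) $ i $ j) \<in> borel_measurable N"
  unfolding matrix_matrix_mult_def by simp

lemma borel_measurable_Tmat:
  fixes A :: "real^'n^'m" and W :: "'a \<Rightarrow> real^'l^'n"
  assumes W: "\<And>i c. (\<lambda>x. W x $ i $ c) \<in> borel_measurable N"
  shows "(\<lambda>x. Tmat A G (W x) $ i $ j) \<in> borel_measurable N"
proof -
  have t: "(\<lambda>x. transpose (W x) $ i $ c) \<in> borel_measurable N" for i c
    using W by (simp add: transpose_def)
  show ?thesis
    unfolding Tmat_def vector_minus_component
    by (intro borel_measurable_diff borel_measurable_matrix_mult borel_measurable_matrix_inv W t
        borel_measurable_const)
qed

text \<open>Measurability is assumed only for factors before \<open>k\<close>, so that the lemma
  applies on the product space of past entries alone.\<close>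

lemma borel_measurable_Tprod:
  fixes A :: "real^'n^'m" and W :: "nat \<Rightarrow> 'a \<Rightarrow> real^'l^'n"
  assumes "\<And>j i c. j < k \<Longrightarrow> (\<lambda>x. W j x $ i $ c) \<in> borel_measurable N"
  shows "(\<lambda>x. Tprod A G (\<lambda>j. W j x) k $ i $ d) \<in> borel_measurable N"
  using assms
  by (induction k arbitrary: i d) (auto intro!: borel_measurable_matrix_mult borel_measurable_Tmat)

lemma borel_measurable_matrix_vector_mult:
  fixes F :: "'a \<Rightarrow> real^'n^'m"
  assumes [measurable]: "\<And>i j. (\<lambda>x. F x $ i $ j) \<in> borel_measurable N"
    "\<And>i. (\<lambda>x. v x $ i) \<in> borel_measurable N"
  shows "(\<lambda>x. (F x *v v x) $ i) \<in> borel_measurable N"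
  unfolding matrix_vector_mult_def by simp

lemma Tprod_cong:
  assumes "\<And>j. j < k \<Longrightarrow> W j = W' j"
  shows "Tprod A G W k = Tprod A G W' k"
  using assms by (induction k) auto

section \<open>The random iteration\<close>

text \<open>One independence statement over triples (step, row, column) encodes both independence
  within each matrix and independence between matrices.\<close>

locale gaussian_sketch = prob_space M for M :: "'s measure" +
  fixes A :: "real^'n^'m" and G :: "real^'m^'m" and e0 :: "real^'n"
    and Om :: "nat \<Rightarrow> 's \<Rightarrow> real^'l^'n"
  assumes injA: "inj ((*v) A)" and spdG: "spd G"
    and card_le: "CARD('l) \<le> CARD('n)"
    and gauss: "\<And>j i c. distributed M lborel (\<lambda>w. Om j w $ i $ c) std_normal_density"
    and indep: "indep_vars (\<lambda>_. borel) (\<lambda>(j, i, c) w. Om j w $ i $ c) UNIV"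
begin

definition B :: "real^'n^'n" where "B = transpose A ** G ** A"

text \<open>The error before step \<open>k\<close>, with \<open>k\<close> factors: T_k ... T_0 e0 is
  \<open>err (Suc k)\<close>.\<close>

definition err :: "nat \<Rightarrow> 's \<Rightarrow> real^'n" where
  "err k w = Tprod A G (\<lambda>j. Om j w) k *v e0"

lemma spdB: "spd B"
  unfolding B_def by (rule spd_gram[OF spdG injA])

lemma err_Suc: "err (Suc k) w = Tmat A G (Om k w) *v err k w"
  by (simp add: err_def matrix_vector_mul_assoc)

lemma Om_measurable: "(\<lambda>w. Om j w $ i $ c) \<in> borel_measurable M"
  using distributed_measurable[OF gauss[of j i c]] by simp

lemma err_measurable: "(\<lambda>w. err k w $ i) \<in> borel_measurable M"
  unfolding err_def
  by (intro borel_measurable_matrix_vector_mult borel_measurable_Tprod Om_measurable) simp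

lemma Berr_measurable: "(\<lambda>w. (B *v err k w) $ i) \<in> borel_measurable M"
  by (intro borel_measurable_matrix_vector_mult err_measurable) simp

text \<open>Two selections are used below: all entries of one matrix, indexed by basis vectors, and
  the entries of one column.\<close>

lemma indep_entries:
  "inj_on h J \<Longrightarrow> indep_vars (\<lambda>_. borel) (\<lambda>b w. Om (fst (h b)) w $ fst (snd (h b)) $ snd (snd (h b))) J"
  using indep_vars_reindex_inj[OF indep, of h J] by (simp add: case_prod_unfold)

lemma AE_inj: "AE w in M. \<forall>j. inj ((*v) (Om j w))"
proof -
  have "AE w in M. Om j w \<notin> {W. \<not> inj ((*v) W)}" for j
  proof (rule AE_not_in_negligible)
    show "negligible {W :: real^'l^'n. \<not> inj ((*v) W)}"
      by (rule negligible_not_inj[OF card_le])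
    \<comment> \<open>Basis vectors of the matrix space are nested axis vectors, so the Euclidean
      coordinates of a matrix are its entries; \<open>p b\<close> is the position.\<close>
    have "\<forall>b \<in> (Basis :: (real^'l^'n) set). \<exists>p. b = axis (fst p) (axis (snd p) 1)"
      by (auto simp: Basis_vec_def)
    then obtain p where p: "\<And>b. b \<in> (Basis :: (real^'l^'n) set) \<Longrightarrow> b = axis (fst (p b)) (axis (snd (p b)) 1)"
      by metis
    have inner: "Om j w \<bullet> b = Om j w $ fst (p b) $ snd (p b)" if "b \<in> Basis" for b w
      by (subst p[OF that]) (simp add: inner_axis)
    show "distributed M lborel (\<lambda>w. Om j w \<bullet> b) std_normal_density" if "b \<in> Basis" for b
      using gauss by (simp add: inner[OF that])
    have "inj_on (\<lambda>b. (j, p b)) Basis"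
      using p by (auto simp: inj_on_def) metis
    from indep_entries[OF this]
    show "indep_vars (\<lambda>_. borel) (\<lambda>b w. Om j w \<bullet> b) Basis"
      by (simp cong: indep_vars_cong add: inner)
  qed
  then show ?thesis by (simp add: AE_all_countable)
qed

section \<open>Energy of the error and its expected decrease\<close>

definition q :: "nat \<Rightarrow> 's \<Rightarrow> real" where "q k w = (mnorm B (err k w))\<^sup>2"

lemma q_eq: "q k w = err k w \<bullet> (B *v err k w)"
  by (simp add: q_def mnorm_sq[OF spdB])

lemma q_measurable: "q k \<in> borel_measurable M"
proof -
  note err_measurable[measurable] Berr_measurable[measurable]
  show ?thesis unfolding q_eq[abs_def] inner_vec_def by simp
qed

text \<open>With competitor \<open>z = 0\<close>, an injective sketch never increases the energy.
  This deterministic bound is the source of integrability below.\<close>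

lemma AE_q_bound: "AE w in M. \<forall>k. q k w \<le> (mnorm B e0)\<^sup>2"
  using AE_inj
proof eventually_elim
  case (elim w)
  show ?case
  proof
    fix k
    show "q k w \<le> (mnorm B e0)\<^sup>2"
    proof (induction k)
      case 0
      then show ?case by (simp add: q_def err_def)
    next
      case (Suc k)
      have "q (Suc k) w \<le> q k w"
        using Tmat_best_approximation[of A G "Om k w" "err k w" 0] spdB elim
        by (simp add: q_def err_Suc B_def)
      with Suc show ?case by simp
    qed
  qed
qed

lemma q_integrable: "integrable M (q k)"
  using AE_q_bound
  by (intro integrable_const_bound[where B = "(mnorm B e0)\<^sup>2"] q_measurable)
     (auto simp: q_def elim: eventually_mono)

text \<open>The product is dominated by the operator norm times the bounded energy. Integrability is
  what lets expectations factor under independence.\<close>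

lemma Berr_product_integrable:
  "integrable M (\<lambda>w. (B *v err k w) $ i * (B *v err k w) $ j)"
proof (rule integrable_const_bound[where B = "onorm ((*v) B) * (mnorm B e0)\<^sup>2"])
  note Berr_measurable[measurable]
  show "(\<lambda>w. (B *v err k w) $ i * (B *v err k w) $ j) \<in> borel_measurable M" by simp
  show "AE w in M. norm ((B *v err k w) $ i * (B *v err k w) $ j) \<le> onorm ((*v) B) * (mnorm B e0)\<^sup>2"
    using AE_q_bound
  proof eventually_elim
    case (elim w)
    let ?y = "B *v err k w"
    have "norm (?y $ i * ?y $ j) \<le> norm ?y * norm ?y"
      unfolding norm_mult using component_le_norm_cart[of ?y] by (intro mult_mono) auto
    also have "\<dots> \<le> onorm ((*v) B) * q k w"
      using spd_norm_sq_le[OF spdB, of "err k w"] by (simp add: q_eq dot_square_norm power2_eq_square)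
    also have "\<dots> \<le> onorm ((*v) B) * (mnorm B e0)\<^sup>2"
      using elim spd_onorm_pos(1)[OF spdB] by (intro mult_left_mono) auto
    finally show ?case .
  qed
qed

text \<open>\<open>err k\<close> reads only entries of steps before \<open>k\<close>, and
  \<open>f\<close> only those of step \<open>k\<close>; disjoint blocks of an independent family are
  independent.\<close>

lemma indep_past_present:
  assumes f: "f \<in> borel_measurable (PiM {p. fst p = k} (\<lambda>_. borel))"
  shows "indep_var borel (\<lambda>w. (B *v err k w) $ i * (B *v err k w) $ j :: real)
    borel (\<lambda>w. f (\<lambda>p\<in>{p. fst p = k}. Om (fst p) w $ fst (snd p) $ snd (snd p)) :: real)"
proof -
  let ?X = "\<lambda>p w. Om (fst p) w $ fst (snd p) $ snd (snd p)"
  let ?P = "{p :: nat \<times> 'n \<times> 'l. fst p < k}" and ?Q = "{p :: nat \<times> 'n \<times> 'l. fst p = k}"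
  \<comment> \<open>The past rebuilt as a function on the product space of entries; entries of step
    \<open>k\<close> or later are not read.\<close>
  define y where "y x = B *v (Tprod A G (\<lambda>j. \<chi> i c. x (j, i, c)) k *v e0)"
    for x :: "nat \<times> 'n \<times> 'l \<Rightarrow> real"
  have y: "(\<lambda>x. y x $ i) \<in> borel_measurable (PiM ?P (\<lambda>_. borel))" for i
  proof -
    have "(\<lambda>x. x (j, i, c)) \<in> borel_measurable (PiM ?P (\<lambda>_. borel :: real measure))"
      if "j < k" for j i c
      using that by (intro measurable_component_singleton) simp
    then show ?thesis unfolding y_def
      by (intro borel_measurable_matrix_vector_mult borel_measurable_Tprod) simp_all
  qed
  have "indep_var (PiM ?P (\<lambda>_. borel)) (\<lambda>w. restrict (\<lambda>p. ?X p w) ?P)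
      (PiM ?Q (\<lambda>_. borel)) (\<lambda>w. restrict (\<lambda>p. ?X p w) ?Q)"
    using indep by (intro indep_var_restrict[where I = UNIV]) (auto simp: case_prod_unfold)
  from indep_var_compose[OF this, of "\<lambda>x. y x $ i * y x $ j" borel f borel]
  have "indep_var borel ((\<lambda>x. y x $ i * y x $ j) \<circ> (\<lambda>w. restrict (\<lambda>p. ?X p w) ?P))
      borel (f \<circ> (\<lambda>w. restrict (\<lambda>p. ?X p w) ?Q))"
    using y f by simp
  moreover have "y (restrict (\<lambda>p. ?X p w) ?P) = B *v err k w" for w
    unfolding y_def err_def
    by (intro arg_cong[where f = "\<lambda>T. B *v (T *v e0)"] Tprod_cong) (simp add: vec_eq_iff)
  ultimately show ?thesis by (simp add: comp_def)
qed

text \<open>Expanding the square gives products of a past factor and a present factor. Expectations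
  factor termwise, and the moment matrix leaves only the diagonal.\<close>

lemma expected_squared_projection:
  fixes c :: 'l and k :: nat
  defines "r \<equiv> \<lambda>w. (column c (Om k w) \<bullet> (B *v err k w))\<^sup>2 / (column c (Om k w) \<bullet> column c (Om k w))"
  shows "integrable M r"
    and "(\<integral>w. r w \<partial>M) = (\<integral>w. (B *v err k w) \<bullet> (B *v err k w) \<partial>M) / CARD('n)"
proof -
  define y where "y i w = (B *v err k w) $ i" for i w
  define X where "X i w = Om k w $ i $ c" for i w
  define D where "D i j w = X i w * X j w / (\<Sum>i\<in>UNIV. (X i w)\<^sup>2)" for i j w
  have r: "r w = (\<Sum>i\<in>UNIV. \<Sum>j\<in>UNIV. (y i w * y j w) * D i j w)" for w
    unfolding r_def inner_vec_def D_def X_def y_def column_def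
    by (simp add: power2_eq_square sum_product sum_divide_distrib mult_ac)
  have "indep_vars (\<lambda>_. borel) X UNIV"
    using indep_entries[of "\<lambda>i. (k, i, c)" UNIV] by (simp add: X_def[abs_def] inj_on_def)
  note moments = gaussian_direction_moments[OF this, unfolded X_def, OF gauss, folded X_def, folded D_def]
  have ind: "indep_var borel (\<lambda>w. y i w * y j w) borel (D i j)" for i j
  proof -
    define f where "f x = x (k, i, c) * x (k, j, c) / (\<Sum>i\<in>UNIV. (x (k, i, c))\<^sup>2)"
      for x :: "nat \<times> 'n \<times> 'l \<Rightarrow> real"
    have [measurable]: "(\<lambda>x. x (k, i, c)) \<in> borel_measurable (PiM {p :: nat \<times> 'n \<times> 'l. fst p = k} (\<lambda>_. borel :: real measure))"
      for i by (rule measurable_component_singleton) simp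
    have "f \<in> borel_measurable (PiM {p. fst p = k} (\<lambda>_. borel))"
      unfolding f_def by measurable
    from indep_past_present[OF this, of i j] show ?thesis
      by (simp add: f_def y_def D_def[abs_def] X_def)
  qed
  have yi: "integrable M (\<lambda>w. y i w * y j w)" for i j
    unfolding y_def by (rule Berr_product_integrable)
  have int: "integrable M (\<lambda>w. (y i w * y j w) * D i j w)" for i j
    by (rule indep_var_integrable[OF ind yi moments(2)])
  then show "integrable M r" unfolding r by (intro Bochner_Integration.integrable_sum)
  have "(\<integral>w. r w \<partial>M) = (\<Sum>i\<in>UNIV. \<Sum>j\<in>UNIV. \<integral>w. (y i w * y j w) * D i j w \<partial>M)"
    unfolding r by (simp add: Bochner_Integration.integral_sum int)
  also have "\<dots> = (\<Sum>i\<in>UNIV. \<Sum>j\<in>UNIV. (\<integral>w. y i w * y j w \<partial>M) * (if i = j then 1 / CARD('n) else 0))"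
    by (intro sum.cong refl) (simp only: indep_var_lebesgue_integral[OF ind yi moments(2)] moments(1))
  also have "\<dots> = (\<Sum>i\<in>UNIV. \<integral>w. y i w * y i w \<partial>M) / CARD('n)"
    by (simp add: sum_divide_distrib if_distrib cong: if_cong)
  also have "(\<Sum>i\<in>UNIV. \<integral>w. y i w * y i w \<partial>M) = (\<integral>w. (B *v err k w) \<bullet> (B *v err k w) \<partial>M)"
    by (simp add: inner_vec_def yi flip: y_def)
  finally show "(\<integral>w. r w \<partial>M) = (\<integral>w. (B *v err k w) \<bullet> (B *v err k w) \<partial>M) / CARD('n)" .
qed

lemma expected_contraction:
  "(\<integral>w. q (Suc k) w \<partial>M) \<le> (1 - 1 / (real CARD('n) * cond2 B)) * (\<integral>w. q k w \<partial>M)"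
proof -
  \<comment> \<open>Any column will do; one exists because types are nonempty, which encodes
    \<open>1 \<le> l\<close>.\<close>
  define c :: 'l where "c = undefined"
  define r where "r w = (column c (Om k w) \<bullet> (B *v err k w))\<^sup>2 / (column c (Om k w) \<bullet> column c (Om k w))" for w
  note r = expected_squared_projection[of c k, folded r_def]
  let ?K = "onorm ((*v) B)" and ?L = "onorm ((*v) (matrix_inv B))"
  note pos = spd_onorm_pos[OF spdB]
  have yy: "integrable M (\<lambda>w. (B *v err k w) \<bullet> (B *v err k w))"
    by (simp add: inner_vec_def Berr_product_integrable)
  have "(\<integral>w. q k w \<partial>M) \<le> (\<integral>w. ?L * ((B *v err k w) \<bullet> (B *v err k w)) \<partial>M)"
    using spd_quadratic_le_onorm_inv[OF spdB]
    by (intro integral_mono q_integrable integrable_mult_right yy) (simp add: q_eq)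
  then have lower: "(\<integral>w. q k w \<partial>M) / ?L \<le> (\<integral>w. (B *v err k w) \<bullet> (B *v err k w) \<partial>M)"
    using pos by (simp add: field_simps)
  have "(\<integral>w. q (Suc k) w \<partial>M) \<le> (\<integral>w. q k w - r w / ?K \<partial>M)"
  proof (rule integral_mono_AE)
    \<comment> \<open>The step bound needs an injective sketch, hence only an almost sure
      comparison.\<close>
    show "AE w in M. q (Suc k) w \<le> q k w - r w / ?K"
      using AE_inj
    proof eventually_elim
      case (elim w)
      then show ?case
        using Tmat_step_bound[of A G "Om k w" "err k w" c] spdB
        by (simp add: q_def err_Suc r_def B_def mult.commute)
    qed
  qed (simp_all add: q_integrable r(1))
  also have "\<dots> = (\<integral>w. q k w \<partial>M) - (\<integral>w. (B *v err k w) \<bullet> (B *v err k w) \<partial>M) / CARD('n) / ?K"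
    using q_integrable r by simp
  also have "\<dots> \<le> (\<integral>w. q k w \<partial>M) - (\<integral>w. q k w \<partial>M) / ?L / CARD('n) / ?K"
    using lower pos by (intro diff_left_mono divide_right_mono) auto
  also have "\<dots> = (1 - 1 / (real CARD('n) * cond2 B)) * (\<integral>w. q k w \<partial>M)"
    by (simp add: cond2_def algebra_simps)
  finally show ?thesis .
qed

lemma expected_error_bound:
  "(\<integral>w. q k w \<partial>M) \<le> (1 - 1 / (real CARD('n) * cond2 B)) ^ k * (mnorm B e0)\<^sup>2"
proof (induction k)
  case 0
  show ?case by (simp add: q_def err_def prob_space)
next
  case (Suc k)
  \<comment> \<open>The rate must be nonnegative to multiply the induction hypothesis by it.\<close>
  have "1 \<le> real CARD('n) * cond2 B"
    using mult_mono[of 1 "real CARD('n)" 1 "cond2 B"] cond2_ge_1[OF spdB] by simp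
  then have "0 \<le> 1 - 1 / (real CARD('n) * cond2 B)" by simp
  from mult_left_mono[OF Suc this] expected_contraction[of k] show ?case
    by (simp add: mult_ac)
qed

end

theorem mainTheorem9:
  fixes A :: "real^'n^'m" and b :: "real^'m" and xs x0 :: "real^'n"
    and G :: "real^'m^'m" and M :: "'s measure" and Om :: "nat \<Rightarrow> 's \<Rightarrow> real^'l^'n"
  assumes rankA: "rank A = CARD('n)"
    and sol: "A *v xs = b"
    and G: "spd G"
    and l: "CARD('l) \<le> CARD('n)"
    and P: "prob_space M"
    and gauss: "\<And>j i c. distributed M lborel (\<lambda>w. Om j w $ i $ c) std_normal_density"
    and indep: "prob_space.indep_vars M (\<lambda>_. borel) (\<lambda>(j, i, c) w. Om j w $ i $ c) UNIV"
  shows "(let Gh = transpose A ** G ** A; e0 = x0 - xs; \<rho> = 1 - 1 / (real CARD('n) * cond2 Gh)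
          in \<rho> < 1 \<and>
             (\<forall>k. (\<integral>w. (mnorm Gh (Tprod A G (\<lambda>j. Om j w) (Suc k) *v e0))\<^sup>2 \<partial>M)
                     \<le> \<rho> * (\<integral>w. (mnorm Gh (Tprod A G (\<lambda>j. Om j w) k *v e0))\<^sup>2 \<partial>M)
                \<and> (\<integral>w. (mnorm Gh (Tprod A G (\<lambda>j. Om j w) (Suc k) *v e0))\<^sup>2 \<partial>M)
                     \<le> \<rho> ^ (k + 1) * (mnorm Gh e0)\<^sup>2))"
proof -
  interpret prob_space M by (rule P)
  interpret gaussian_sketch M A G "x0 - xs" Om
    using rankA G l gauss indep by unfold_locales (simp_all add: full_rank_injective)
  have "cond2 B > 0" using cond2_ge_1[OF spdB] by simp
  then show ?thesis
    \<comment> \<open>\<open>Suc k\<close> factors match the exponent \<open>k + 1\<close>.\<close>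
    using expected_contraction expected_error_bound[of "Suc _"]
    unfolding q_def err_def B_def Let_def by simp
qed

end
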